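(* Let $\mathcal G$ be a directed tree, let $\mu$ be the Möbius function of the poset $P_{\mathcal G}$, and let $s,s'\in P_{\mathcal G}$ with $s'\preceq s$. If $s$ has more than one element in its lower cover, then $$\mu(s',s)=\begin{cases}-1&\text{if } s \text{ covers } s',\\ 1&\text{if } s'=s \text{ or } s'=\bigwedge_{s''\text{ covered by }s}s'',\\ 0&\text{otherwise.}\end{cases}$$ If $s$ has exactly one element in its lower cover, then $$\mu(s',s)=\begin{cases}-1&\text{if } s \text{ covers } s',\\ 1&\text{if } s'=s,\\ 0&\text{otherwise.}\end{cases}$$
   Context: A directed tree $\mathcal G=([m],E)$ is a directed acyclic graph on $[m]=\{1,\dots,m\}$ whose underlying undirected graph is a tree and which has a unique source node. A trek between $i$ and $j$ is a pair $T=\{P,Q\}$ of directed paths (length zero allowed) with a common starting node, $P$ ending at $i$ and $Q$ ending at $j$; its length is $|P|+|Q|$ (number of edges). Let $N$ be the length of the longest trek in $\mathcal G$. For $i,j\in[m]$ let $t(i,j)\in\mathbb Z_{\ge0}^{\{0,1,\dots,N\}}$ be the vector whose $k$-th entry is the number of treks between $i$ and $j$ of length $k$. The poset $P_{\mathcal G}$ has as ground set all coordinatewise minima $\bigwedge_{(i,j)\in S}t(i,j)$ over nonempty $S\subseteq\{(i,j):1\le i\le j\le m\}$, ordered by the coordinatewise order $\preceq$; $\wedge$ denotes coordinatewise minimum. The lower cover of $s$ is the set of elements covered by $s$. The Möbius function is defined by $\mu(s,s)=1$ and $\mu(s,u)=-\sum_{s\preceq t\prec u}\mu(s,t)$ for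 $s\prec u$. *)

theory Defs
  imports "Graph_Theory.Pair_Digraph" "Graph_Theory.Digraph_Component" "Graph_Theory.Vertex_Walk"
begin

text \<open>
  Directed trees. The constant \<^const>\<open>tree\<close> of the library only asks for connectedness and the
  absence of \<^emph>\<open>directed\<close> cycles, so it does not say that the underlying undirected graph is a tree.
  That graph is represented by its symmetric digraph \<^term>\<open>mk_symmetric G\<close>; an undirected cycle
  is a path on at least three vertices whose end vertices are adjacent (traversing an edge back
  and forth does not count).
\<close>

definition underlying_tree :: "'a pair_pre_digraph \<Rightarrow> bool" where
  "underlying_tree G \<longleftrightarrow>
     connected (with_proj G) \<and>
     \<not> (\<exists>p. vpath p (with_proj (mk_symmetric (with_proj G))) \<and> length p \<ge> 3 \<and>
           (last p, hd p) \<in> parcs (mk_symmetric (with_proj G)))"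

definition directed_tree :: "nat \<Rightarrow> nat pair_pre_digraph \<Rightarrow> bool" where
  "directed_tree m G \<longleftrightarrow>
     pair_wf_digraph G \<and> pverts G = {1..m} \<and>
     acyclic (parcs G) \<and> underlying_tree G \<and>
     (\<exists>!r. r \<in> pverts G \<and> (\<nexists>u. (u, r) \<in> parcs G))"

text \<open>
  Directed paths are nonempty vertex lists, so a path of length zero is a list \<open>[v]\<close>.
  The two paths of a trek may share edges.
\<close>

type_synonym 'a trek = "'a vwalk \<times> 'a vwalk"

definition treks :: "'a pair_pre_digraph \<Rightarrow> 'a \<Rightarrow> 'a \<Rightarrow> 'a trek set" where
  "treks G i j = {(P, Q). vpath P (with_proj G) \<and> vpath Q (with_proj G) \<and>
                          hd P = hd Q \<and> last P = i \<and> last Q = j}"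

definition trek_length :: "'a trek \<Rightarrow> nat" where
  "trek_length T = vwalk_length (fst T) + vwalk_length (snd T)"

definition max_trek_length :: "'a pair_pre_digraph \<Rightarrow> nat" where
  "max_trek_length G = Max {trek_length T | T i j. i \<in> pverts G \<and> j \<in> pverts G \<and> T \<in> treks G i j}"

text \<open>
  Vectors indexed by \<open>{0..N}\<close> are functions on the natural numbers that vanish above \<open>N\<close>, so that
  the coordinatewise order and minimum are the library's \<open>\<le>\<close> and \<open>\<sqinter>\<close> on functions.
\<close>

definition trek_vector :: "'a pair_pre_digraph \<Rightarrow> 'a \<Rightarrow> 'a \<Rightarrow> nat \<Rightarrow> nat" where
  "trek_vector G i j = (\<lambda>k. if k \<le> max_trek_length G
                            then card {T \<in> treks G i j. trek_length T = k} else 0)"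

definition trek_poset :: "nat pair_pre_digraph \<Rightarrow> (nat \<Rightarrow> nat) set" where
  "trek_poset G = {Inf_fin ((\<lambda>(i, j). trek_vector G i j) ` S) | S.
                     S \<noteq> {} \<and> S \<subseteq> {(i, j). i \<in> pverts G \<and> j \<in> pverts G \<and> i \<le> j}}"

text \<open>Covers and the Moebius function of a set with the order inherited from its type.\<close>

definition covers_in :: "'a::order set \<Rightarrow> 'a \<Rightarrow> 'a \<Rightarrow> bool" where
  "covers_in P s s' \<longleftrightarrow> s \<in> P \<and> s' \<in> P \<and> s' < s \<and> \<not> (\<exists>t\<in>P. s' < t \<and> t < s)"

definition lower_cover :: "'a::order set \<Rightarrow> 'a \<Rightarrow> 'a set" where
  "lower_cover P s = {s'. covers_in P s s'}"

text \<open>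
  The finiteness test only serves termination; the value 0 outside the relation \<open>s \<le> u\<close>
  is a dummy.
\<close>

function moebius :: "'a::order set \<Rightarrow> 'a \<Rightarrow> 'a \<Rightarrow> int" where
  "moebius P s u =
     (if finite P then
        if s = u then 1
        else if s < u then - (\<Sum>t\<in>{t \<in> P. s \<le> t \<and> t < u}. moebius P s t)
        else 0
      else 0)"
  by pat_completeness auto
termination
proof (relation "measure (\<lambda>(P, s, u). card {t \<in> P. t < u})")
  fix P :: "'a set" and s u t
  assume fin: "finite P" and t: "t \<in> {t \<in> P. s \<le> t \<and> t < u}"
  have "{v \<in> P. v < t} \<subset> {v \<in> P. v < u}"
    using t by (auto intro: less_trans)
  then have "card {v \<in> P. v < t} < card {v \<in> P. v < u}"
    using fin by (intro psubset_card_mono) auto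
  then show "((P, s, t), (P, s, u)) \<in> measure (\<lambda>(P, s, u). card {t \<in> P. t < u})"
    by simp
qed simp

declare moebius.simps [simp del]

end

theory Submission
  imports Defs
begin

text \<open>
  In a rooted tree the treks between \<open>i\<close> and \<open>j\<close> correspond to the common ancestors, so
  \<open>t(i,j)\<close> is the indicator of an arithmetic progression of step 2, from the distance of \<open>i\<close>
  and \<open>j\<close> to the sum of their depths, and so is every nonzero element of the poset (with other
  end points). Let \<open>d\<close> be the greatest element of the support of \<open>s\<close>. The elements below \<open>s\<close>
  with \<open>d\<close> in the support form a chain. If \<open>d \<ge> 2\<close>, then those without it lie below
  \<open>s \<sqinter> t(x,y)\<close>, where \<open>x\<close> and \<open>y\<close> lie on one root path, have depth sum \<open>d - 2\<close> and depths
  differing by at most 1; if \<open>d < 2\<close>, then the only one is 0. Hence \<open>s\<close> has at most two lower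
  covers, and the elements strictly below \<open>s\<close> form one principal down-set or two meeting in a
  third, over each of which the Moebius function is easily summed.
\<close>

section \<open>Moebius function above one or two lower covers in a finite poset\<close>

text \<open>By finiteness the \<open>t\<close> with \<open>u \<le> t < s\<close> have a maximal
  member, and \<open>s\<close> covers it.\<close>

lemma below_lower_cover:
  assumes "finite P" "s \<in> P" "u \<in> P" "u < s"
  shows "\<exists>w \<in> lower_cover P s. u \<le> w"
proof -
  let ?A = "{t \<in> P. u \<le> t \<and> t < s}"
  have "finite ?A" "u \<in> ?A" using assms by auto
  then obtain w where w: "w \<in> ?A" "\<And>t. t \<in> ?A \<Longrightarrow> w \<le> t \<Longrightarrow> w = t"
    using finite_has_maximal[of ?A] by (metis (no_types, lifting) empty_iff)
  have "\<not> (\<exists>t\<in>P. w < t \<and> t < s)"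
    using w by (metis (mono_tags, lifting) mem_Collect_eq order.strict_iff_order order_trans)
  then have "w \<in> lower_cover P s"
    using w(1) assms by (simp add: lower_cover_def covers_in_def)
  then show ?thesis using w(1) by auto
qed

lemma lower_cover_eq:
  assumes "w \<in> lower_cover P s" "u \<in> P" "w \<le> u" "u < s"
  shows "w = u"
  using assms by (auto simp: lower_cover_def covers_in_def order.strict_iff_order)

lemma finite_lower_cover: "finite P \<Longrightarrow> finite (lower_cover P s)"
  by (rule finite_subset[of _ P]) (auto simp: lower_cover_def covers_in_def)

text \<open>The recursion with its last term moved to the left side. The case of an empty interval
  is included, so that the bound \<open>b\<close> may be any lower cover or meet, whether or not it
  lies above \<open>a\<close>.\<close>

lemma sum_moebius_atMost:
  assumes "finite P" "b \<in> P"
  shows "(\<Sum>t\<in>{t \<in> P. a \<le> t \<and> t \<le> b}. moebius P a t) = (if a = b then 1 else 0)"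
proof -
  consider "a = b" | "a < b" | "\<not> a \<le> b" by (auto simp: order.strict_iff_order)
  then show ?thesis
  proof cases
    case 1
    then have "{t \<in> P. a \<le> t \<and> t \<le> b} = {b}" using assms by auto
    then show ?thesis using 1 assms by (simp add: moebius.simps)
  next
    case 2
    then have "{t \<in> P. a \<le> t \<and> t \<le> b} = insert b {t \<in> P. a \<le> t \<and> t < b}"
      using assms by (auto simp: order.strict_iff_order)
    moreover have "moebius P a b = - (\<Sum>t\<in>{t \<in> P. a \<le> t \<and> t < b}. moebius P a t)"
      using 2 assms by (subst moebius.simps) auto
    ultimately show ?thesis using 2 assms by simp
  next
    case 3
    then have "{t \<in> P. a \<le> t \<and> t \<le> b} = {}" using order_trans by blast
    with 3 show ?thesis by (metis order_refl sum.empty)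
  qed
qed

text \<open>Everything strictly below \<open>s\<close> lies below \<open>w\<close>, so the recursion
  sums over a closed interval ending in \<open>w\<close>.\<close>

lemma moebius_single_lower_cover:
  assumes "finite P" "s \<in> P" "s' \<in> P" "s' \<le> s" "lower_cover P s = {w}"
  shows "moebius P s' s = (if covers_in P s s' then -1 else if s' = s then 1 else 0)"
proof (cases "s' = s")
  case True
  then show ?thesis using assms by (subst moebius.simps) (simp add: covers_in_def)
next
  case False
  then have lt: "s' < s" using assms by simp
  have w: "w \<in> P" "w < s"
    using assms(5) unfolding lower_cover_def covers_in_def by auto
  have cov: "covers_in P s s' \<longleftrightarrow> s' = w"
    using assms(5) unfolding lower_cover_def by auto
  have "{t \<in> P. s' \<le> t \<and> t < s} = {t \<in> P. s' \<le> t \<and> t \<le> w}"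
    using below_lower_cover[of P s] assms w by (auto dest: order.strict_trans1)
  then have "moebius P s' s = - (if s' = w then 1 else 0)"
    using assms lt w sum_moebius_atMost[of P w s'] by (subst moebius.simps) auto
  then show ?thesis using cov False by auto
qed

text \<open>Inclusion-exclusion: the elements strictly below \<open>s\<close> form the down-sets of
  \<open>v\<close> and \<open>w\<close>, which intersect in the down-set of
  \<open>inf v w\<close>.\<close>

lemma moebius_two_lower_covers:
  fixes s :: "'a::semilattice_inf"
  assumes "finite P" "s \<in> P" "s' \<in> P" "s' \<le> s" "lower_cover P s = {v, w}" "v \<noteq> w"
    and "inf v w \<in> P"
  shows "moebius P s' s =
    (if covers_in P s s' then -1 else if s' = s \<or> s' = inf v w then 1 else 0)"
proof (cases "s' = s")
  case True
  then show ?thesis using assms by (subst moebius.simps) (simp add: covers_in_def)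
next
  case False
  then have lt: "s' < s" using assms by simp
  have vw: "v \<in> lower_cover P s" "w \<in> lower_cover P s" using assms by auto
  then have P: "v \<in> P" "w \<in> P" "v < s" "w < s"
    unfolding lower_cover_def covers_in_def by auto
  have cov: "covers_in P s s' \<longleftrightarrow> s' = v \<or> s' = w"
    using assms(5) unfolding lower_cover_def by auto
  \<comment> \<open>Distinct lower covers are incomparable, so the meet is neither of them and the
    cases of the formula do not overlap.\<close>
  have ninf: "inf v w \<noteq> v" "inf v w \<noteq> w"
    using lower_cover_eq[OF vw(1) P(2)] lower_cover_eq[OF vw(2) P(1)] P assms(6)
    by (metis inf.cobounded2, metis inf.cobounded1)
  let ?B = "\<lambda>b. {t \<in> P. s' \<le> t \<and> t \<le> b}"
  have 1: "{t \<in> P. s' \<le> t \<and> t < s} = ?B v \<union> ?B w"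
    using below_lower_cover[of P s] assms P by (auto dest: order.strict_trans1)
  have 2: "?B v \<inter> ?B w = ?B (inf v w)" by auto
  have "sum (moebius P s') (?B v \<union> ?B w) + sum (moebius P s') (?B v \<inter> ?B w)
      = sum (moebius P s') (?B v) + sum (moebius P s') (?B w)"
    using assms(1) by (intro sum.union_inter) auto
  moreover have "sum (moebius P s') (?B b) = (if s' = b then 1 else 0)" if "b \<in> P" for b
    using sum_moebius_atMost[OF assms(1) that] .
  ultimately have "sum (moebius P s') {t \<in> P. s' \<le> t \<and> t < s}
      = (if s' = v then 1 else 0) + (if s' = w then 1 else 0) - (if s' = inf v w then 1 else 0)"
    unfolding 1 2 using assms(7) P by (simp only: eq_diff_eq)
  moreover have "moebius P s' s = - sum (moebius P s') {t \<in> P. s' \<le> t \<and> t < s}"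
    using assms lt by (subst moebius.simps) auto
  ultimately show ?thesis using cov False ninf assms(6) by auto
qed

section \<open>Indicators of arithmetic progressions of step 2\<close>

text \<open>Formulated by parity and convexity instead of end points: these conditions pass directly
  to minima, and the empty support is included.\<close>

definition step2_interval :: "(nat \<Rightarrow> nat) \<Rightarrow> bool" where
  "step2_interval s \<longleftrightarrow> (\<forall>k. s k \<le> 1) \<and>
     (\<forall>k l. s k \<noteq> 0 \<longrightarrow> s l \<noteq> 0 \<longrightarrow> even k = even l) \<and>
     (\<forall>k l n. s k \<noteq> 0 \<longrightarrow> s n \<noteq> 0 \<longrightarrow> k \<le> l \<longrightarrow> l \<le> n \<longrightarrow> even l = even k \<longrightarrow> s l \<noteq> 0)"

lemma step2_intervalD:
  assumes "step2_interval s"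
  shows step2_interval_le_1: "s k \<le> 1"
    and step2_interval_parity: "s k \<noteq> 0 \<Longrightarrow> s l \<noteq> 0 \<Longrightarrow> even k = even l"
    and step2_interval_convex:
      "s k \<noteq> 0 \<Longrightarrow> s n \<noteq> 0 \<Longrightarrow> k \<le> l \<Longrightarrow> l \<le> n \<Longrightarrow> even l = even k \<Longrightarrow> s l \<noteq> 0"
  using assms unfolding step2_interval_def by blast+

lemma step2_interval_inf:
  assumes "step2_interval s" "step2_interval t"
  shows "step2_interval (inf s t)"
proof -
  have nz: "inf s t k \<noteq> 0 \<longleftrightarrow> s k \<noteq> 0 \<and> t k \<noteq> 0" for k
    by (auto simp: inf_nat_def min_def)
  have "inf s t k \<le> 1" for k
    using step2_interval_le_1[OF assms(1), of k] by (simp add: le_infI1)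
  moreover have "even k = even l" if "s k \<noteq> 0" "s l \<noteq> 0" for k l
    using step2_interval_parity[OF assms(1)] that .
  moreover have "s l \<noteq> 0 \<and> t l \<noteq> 0"
    if "s k \<noteq> 0" "t k \<noteq> 0" "s n \<noteq> 0" "t n \<noteq> 0" "k \<le> l" "l \<le> n" "even l = even k" for k l n
    using step2_interval_convex[OF assms(1)] step2_interval_convex[OF assms(2)] that by blast
  ultimately show ?thesis
    unfolding step2_interval_def nz by meson
qed

text \<open>Both progressions end in \<open>d\<close>, so each is determined by its first element,
  and the one that starts earlier contains the other.\<close>

lemma step2_interval_comparable:
  assumes "step2_interval s" "step2_interval t" "s d \<noteq> 0" "t d \<noteq> 0"
    and "\<And>k. d < k \<Longrightarrow> s k = 0 \<and> t k = 0"
  shows "s \<le> t \<or> t \<le> s"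
proof (rule ccontr)
  assume "\<not> ?thesis"
  then obtain k l where "\<not> s k \<le> t k" "\<not> t l \<le> s l"
    by (auto simp: le_fun_def)
  moreover have "s k \<le> 1" "t l \<le> 1" using assms step2_interval_le_1 by blast+
  ultimately have kl: "s k \<noteq> 0" "t k = 0" "t l \<noteq> 0" "s l = 0" by linarith+
  then have d: "k \<le> d" "l \<le> d" using assms(5) by (meson not_le)+
  have ev: "even k = even d" "even l = even d"
    using kl step2_interval_parity[OF assms(1) _ assms(3)] step2_interval_parity[OF assms(2) _ assms(4)]
    by blast+
  show False
  proof (cases "k \<le> l")
    case True
    then have "s l \<noteq> 0"
      using step2_interval_convex[OF assms(1) kl(1) assms(3)] d ev by blast
    with kl show False by simp
  next
    case False
    then have "k \<ge> l" by simp
    then have "t k \<noteq> 0"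
      using step2_interval_convex[OF assms(2) kl(3) assms(4)] d ev by blast
    with kl show False by simp
  qed
qed

section \<open>Treks in rooted forests\<close>

text \<open>The axioms force \<open>depth\<close> to be the number of arcs from the root of the
  component: a vertex of depth 0 has no parent, and every arc adds one.\<close>

locale rooted_forest =
  fixes G :: "'a pair_pre_digraph" and depth :: "'a \<Rightarrow> nat"
  assumes arcs_in_verts: "parcs G \<subseteq> pverts G \<times> pverts G"
    and depth_arc: "(u, v) \<in> parcs G \<Longrightarrow> depth v = Suc (depth u)"
    and parent_unique: "(u, v) \<in> parcs G \<Longrightarrow> (u', v) \<in> parcs G \<Longrightarrow> u = u'"
    and parent_exists: "v \<in> pverts G \<Longrightarrow> depth v > 0 \<Longrightarrow> \<exists>u. (u, v) \<in> parcs G"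
begin

lemma relpow_depth: "(a, i) \<in> parcs G ^^ p \<Longrightarrow> depth i = depth a + p"
  by (induction p arbitrary: i) (auto dest: depth_arc)

lemma relpow_source_unique:
  "(a, i) \<in> parcs G ^^ p \<Longrightarrow> (b, i) \<in> parcs G ^^ p \<Longrightarrow> a = b"
  by (induction p arbitrary: i) (auto dest: parent_unique)

lemma ancestor_exists:
  assumes "i \<in> pverts G" "p \<le> depth i"
  shows "\<exists>a \<in> pverts G. (a, i) \<in> parcs G ^^ p"
  using assms
proof (induction p arbitrary: i)
  case (Suc p)
  then obtain u where u: "(u, i) \<in> parcs G" using parent_exists[of i] by auto
  then have "u \<in> pverts G" "p \<le> depth u"
    using arcs_in_verts depth_arc[OF u] Suc.prems by auto
  with Suc.IH obtain a where "a \<in> pverts G" "(a, u) \<in> parcs G ^^ p" by blast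
  with u show ?case by auto
qed auto

lemma vwalk_snoc_iff:
  "P \<noteq> [] \<Longrightarrow> vwalk (P @ [x]) (with_proj G) \<longleftrightarrow> vwalk P (with_proj G) \<and> (last P, x) \<in> parcs G"
  using arcs_in_verts by (auto simp: vwalk_def vwalk_arcs_append)

lemma vwalk_relpow:
  "vwalk P (with_proj G) \<Longrightarrow> (hd P, last P) \<in> parcs G ^^ (length P - 1)"
proof (induction P rule: rev_induct)
  case Nil
  then show ?case by (simp add: vwalk_def)
next
  case (snoc x P)
  show ?case
  proof (cases "P = []")
    case False
    then have "(hd P, last P) \<in> parcs G ^^ (length P - 1)" "(last P, x) \<in> parcs G"
      using snoc vwalk_snoc_iff by blast+
    then have "(hd P, x) \<in> parcs G ^^ Suc (length P - 1)" by auto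
    with False show ?thesis by simp
  qed simp
qed

text \<open>Parents are unique, so a walk can be reconstructed backwards from its last
  vertex.\<close>

lemma vwalk_eqI:
  "vwalk P (with_proj G) \<Longrightarrow> vwalk Q (with_proj G) \<Longrightarrow> last P = last Q \<Longrightarrow>
   length P = length Q \<Longrightarrow> P = Q"
proof (induction P arbitrary: Q rule: rev_induct)
  case Nil
  then show ?case by simp
next
  case (snoc x P)
  from snoc.prems obtain R where Q: "Q = R @ [x]" "length R = length P"
    by (metis append_butlast_last_id butlast_snoc last_snoc length_butlast length_0_conv snoc_eq_iff_butlast)
  show ?case
  proof (cases "P = []")
    case False
    then have "R \<noteq> []" using Q by auto
    then have "vwalk P (with_proj G)" "vwalk R (with_proj G)"
      "(last P, x) \<in> parcs G" "(last R, x) \<in> parcs G"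
      using snoc.prems False Q vwalk_snoc_iff by blast+
    then show ?thesis using snoc.IH[of R] parent_unique Q by simp
  qed (use Q in simp)
qed

lemma relpow_vpath:
  assumes "(a, i) \<in> parcs G ^^ p" "a \<in> pverts G"
  shows "\<exists>P. vpath P (with_proj G) \<and> hd P = a \<and> last P = i \<and> length P = Suc p"
proof -
  \<comment> \<open>The depth bound strengthens the induction: the appended vertex is one level
    deeper than all earlier ones, hence new, and the walk stays a path.\<close>
  from assms(1) have "\<exists>P. vpath P (with_proj G) \<and> hd P = a \<and> last P = i \<and> length P = Suc p
      \<and> (\<forall>x \<in> set P. depth x \<le> depth i)"
  proof (induction p arbitrary: i)
    case 0
    then show ?case using assms(2) by (intro exI[of _ "[a]"]) (auto simp: vpath_def)
  next
    case (Suc p)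
    then obtain j where j: "(a, j) \<in> parcs G ^^ p" "(j, i) \<in> parcs G" by auto
    with Suc.IH obtain P where P: "vpath P (with_proj G)" "hd P = a" "last P = j"
      "length P = Suc p" "\<forall>x \<in> set P. depth x \<le> depth j" by blast
    have "P \<noteq> []" using P(4) by auto
    moreover have "depth i = Suc (depth j)" using depth_arc j by blast
    ultimately show ?case using P j vwalk_snoc_iff
      by (intro exI[of _ "P @ [i]"]) (auto simp: vpath_def le_Suc_eq)
  qed
  then show ?thesis by blast
qed

text \<open>Relation powers replace vertex lists here; \<open>a\<close> is the common start of the
  two paths.\<close>

definition trek_lengths :: "'a \<Rightarrow> 'a \<Rightarrow> nat set" where
  "trek_lengths i j =
     {p + q | a p q. a \<in> pverts G \<and> (a, i) \<in> parcs G ^^ p \<and> (a, j) \<in> parcs G ^^ q}"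

lemma trek_lengths_altdef:
  "trek_lengths i j = trek_length ` treks G i j"
proof (intro equalityI subsetI)
  fix k assume "k \<in> trek_lengths i j"
  then obtain a p q where "k = p + q" "a \<in> pverts G"
    "(a, i) \<in> parcs G ^^ p" "(a, j) \<in> parcs G ^^ q" by (auto simp: trek_lengths_def)
  moreover from this obtain P Q where
    "vpath P (with_proj G)" "hd P = a" "last P = i" "length P = Suc p"
    "vpath Q (with_proj G)" "hd Q = a" "last Q = j" "length Q = Suc q"
    using relpow_vpath by metis
  ultimately show "k \<in> trek_length ` treks G i j"
    by (intro image_eqI[of _ _ "(P, Q)"]) (auto simp: treks_def trek_length_def)
next
  fix k assume "k \<in> trek_length ` treks G i j"
  then obtain P Q where PQ: "k = (length P - 1) + (length Q - 1)" "vpath P (with_proj G)"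
    "vpath Q (with_proj G)" "hd P = hd Q" "last P = i" "last Q = j"
    by (auto simp: treks_def trek_length_def)
  then have w: "vwalk P (with_proj G)" "vwalk Q (with_proj G)" by auto
  then have "hd P \<in> pverts G" by (auto simp: vwalk_def)
  moreover have "(hd P, i) \<in> parcs G ^^ (length P - 1)" "(hd P, j) \<in> parcs G ^^ (length Q - 1)"
    using vwalk_relpow w PQ by metis+
  ultimately show "k \<in> trek_lengths i j" unfolding trek_lengths_def PQ(1) by blast
qed

text \<open>The depths of \<open>i\<close> and \<open>j\<close> fix the difference of the two path
  lengths and the trek length fixes their sum. The lengths and the end points then determine the
  paths.\<close>

lemma trek_length_inj: "inj_on trek_length (treks G i j)"
proof (rule inj_onI, clarify)
  fix P Q P' Q' assume T: "(P, Q) \<in> treks G i j" "(P', Q') \<in> treks G i j"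
    and len: "trek_length (P, Q) = trek_length (P', Q')"
  have *: "vwalk P (with_proj G)" "vwalk Q (with_proj G)" "hd P = hd Q" "last P = i" "last Q = j"
    "vwalk P' (with_proj G)" "vwalk Q' (with_proj G)" "hd P' = hd Q'" "last P' = i" "last Q' = j"
    using T by (auto simp: treks_def)
  have dep: "depth (last R) = depth (hd R) + (length R - 1)" if "vwalk R (with_proj G)" for R
    using vwalk_relpow[OF that] relpow_depth by blast
  have pos: "length P > 0" "length Q > 0" "length P' > 0" "length Q' > 0"
    using * by (auto simp: vwalk_def)
  have "length P - 1 + (length Q - 1) = length P' - 1 + (length Q' - 1)"
    using len by (simp add: trek_length_def)
  then have "length P = length P'" "length Q = length Q'"
    using dep[OF *(1)] dep[OF *(2)] dep[OF *(6)] dep[OF *(7)] pos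
    unfolding *(3-5) *(8-10) by linarith+
  then show "P = P' \<and> Q = Q'" using vwalk_eqI * by metis
qed

lemma trek_vector_eq:
  "trek_vector G i j k = (if k \<le> max_trek_length G \<and> k \<in> trek_lengths i j then 1 else 0)"
proof -
  let ?T = "{T \<in> treks G i j. trek_length T = k}"
  have "\<exists>T. ?T = {T}" if k: "k \<in> trek_lengths i j"
    using that trek_length_inj[of i j] unfolding trek_lengths_altdef inj_on_def by blast
  moreover have "?T = {}" if "k \<notin> trek_lengths i j"
    using that unfolding trek_lengths_altdef by blast
  ultimately have "card ?T = (if k \<in> trek_lengths i j then 1 else 0)"
    by (metis card.empty is_singletonI is_singleton_altdef)
  then show ?thesis by (simp add: trek_vector_def)
qed

lemma trek_lengths_le: "k \<in> trek_lengths i j \<Longrightarrow> k \<le> depth i + depth j"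
  by (auto simp: trek_lengths_def dest!: relpow_depth)

lemma trek_lengths_parity: "k \<in> trek_lengths i j \<Longrightarrow> even k = even (depth i + depth j)"
  by (auto simp: trek_lengths_def dest!: relpow_depth)

text \<open>Moving the common start \<open>a\<close> of the shorter trek up by \<open>c\<close>
  levels lengthens both paths by \<open>c\<close>, and so the trek by \<open>2 * c\<close>.\<close>

lemma trek_lengths_convex:
  assumes "k \<in> trek_lengths i j" "n \<in> trek_lengths i j" "k \<le> l" "l \<le> n" "even l = even k"
  shows "l \<in> trek_lengths i j"
proof -
  obtain a p q where 1: "k = p + q" "a \<in> pverts G" "(a, i) \<in> parcs G ^^ p" "(a, j) \<in> parcs G ^^ q"
    using assms(1) by (auto simp: trek_lengths_def)
  obtain b p' q' where 2: "n = p' + q'" "(b, i) \<in> parcs G ^^ p'" "(b, j) \<in> parcs G ^^ q'"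
    using assms(2) by (auto simp: trek_lengths_def)
  have dep: "depth i = depth a + p" "depth j = depth a + q" "depth i = depth b + p'"
    "depth j = depth b + q'"
    using 1 2 relpow_depth by blast+
  have "\<exists>c. l = k + 2 * c" using assms(3,5) by presburger
  then obtain c where c: "l = k + 2 * c" by blast
  \<comment> \<open>Both treks have the same difference of path lengths, so \<open>a\<close> is
    deeper than \<open>b\<close> by half of \<open>n - k\<close>; this leaves room to climb
    \<open>c\<close> levels.\<close>
  have "p' + q = p + q'" using dep by linarith
  then have "c \<le> depth a"
    using assms(4) c 1(1) 2(1) dep by linarith
  then obtain e where e: "e \<in> pverts G" "(e, a) \<in> parcs G ^^ c"
    using ancestor_exists 1(2) by blast
  then have "(e, i) \<in> parcs G ^^ (c + p)" "(e, j) \<in> parcs G ^^ (c + q)"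
    using 1 unfolding relpow_add by blast+
  moreover have "l = (c + p) + (c + q)" using c 1 by simp
  ultimately show ?thesis using e unfolding trek_lengths_def by blast
qed

lemma step2_interval_trek_vector: "step2_interval (trek_vector G i j)"
proof -
  have nz: "trek_vector G i j k \<noteq> 0 \<longleftrightarrow> k \<le> max_trek_length G \<and> k \<in> trek_lengths i j" for k
    by (simp add: trek_vector_eq)
  show ?thesis
    unfolding step2_interval_def nz
  proof (intro conjI allI impI)
    show "trek_vector G i j k \<le> 1" for k by (simp add: trek_vector_eq)
  qed (use trek_lengths_parity trek_lengths_convex in \<open>meson order_trans\<close>)+
qed

text \<open>The index pairs of the poset satisfy \<open>i \<le> j\<close>; symmetry frees later
  witnesses from this restriction.\<close>

lemma trek_lengths_commute: "trek_lengths i j = trek_lengths j i"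
proof -
  have "trek_lengths i j \<subseteq> trek_lengths j i" for i j
  proof
    fix k assume "k \<in> trek_lengths i j"
    then obtain a p q where "k = p + q" "a \<in> pverts G"
      "(a, i) \<in> parcs G ^^ p" "(a, j) \<in> parcs G ^^ q"
      by (auto simp: trek_lengths_def)
    moreover from this have "k = q + p" by simp
    ultimately show "k \<in> trek_lengths j i" unfolding trek_lengths_def by blast
  qed
  then show ?thesis by blast
qed

lemma trek_vector_commute: "trek_vector G i j = trek_vector G j i"
  using trek_lengths_commute by (auto simp: trek_vector_eq)

text \<open>
  The witnesses are vertices of depths \<open>d div 2\<close> and \<open>d - d div 2\<close> on one root path.
\<close>

lemma full_trek_lengths:
  assumes "v \<in> pverts G" "d \<le> 2 * depth v"
  shows "\<exists>x \<in> pverts G. \<exists>y \<in> pverts G. trek_lengths x y = {k. k \<le> d \<and> even k = even d}"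
proof -
  define e where "e = d div 2"
  obtain y where y: "y \<in> pverts G" "(y, v) \<in> parcs G ^^ (depth v - (d - e))"
    using ancestor_exists[of v "depth v - (d - e)"] assms by auto
  have dy: "depth y = d - e"
    using relpow_depth[OF y(2)] assms(2) unfolding e_def by linarith
  \<comment> \<open>The exponent \<open>d - 2 * e\<close> is the parity of \<open>d\<close>, so
    \<open>x\<close> is \<open>y\<close> itself or the parent of \<open>y\<close>.\<close>
  obtain x where x: "x \<in> pverts G" "(x, y) \<in> parcs G ^^ (d - 2 * e)"
    using ancestor_exists[of y "d - 2 * e"] y dy by fastforce
  have dx: "depth x = e"
    using relpow_depth[OF x(2)] dy unfolding e_def by linarith
  have "k \<in> trek_lengths x y \<longleftrightarrow> k \<le> d \<and> even k = even d" for k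
  proof
    assume "k \<in> trek_lengths x y"
    then show "k \<le> d \<and> even k = even d"
      using trek_lengths_le[of k x y] trek_lengths_parity[of k x y] dx dy e_def by auto
  next
    assume k: "k \<le> d \<and> even k = even d"
    \<comment> \<open>The trek of length \<open>k\<close> starts \<open>k div 2\<close> levels above
      \<open>x\<close>; the path to \<open>y\<close> is longer by the parity of \<open>d\<close>,
      which is that of \<open>k\<close>.\<close>
    then have "k div 2 \<le> depth x" unfolding dx e_def by (simp add: div_le_mono)
    then obtain a where a: "a \<in> pverts G" "(a, x) \<in> parcs G ^^ (k div 2)"
      using ancestor_exists x(1) by blast
    then have "(a, y) \<in> parcs G ^^ (k div 2 + (d - 2 * e))"
      using x(2) unfolding relpow_add by blast
    moreover have "k = k div 2 + (k div 2 + (d - 2 * e))"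
      using k unfolding e_def by presburger
    ultimately show "k \<in> trek_lengths x y"
      using a unfolding trek_lengths_def by blast
  qed
  then show ?thesis using x(1) y(1) by blast
qed

end

section \<open>The poset of trek vectors: finiteness, meets and lower covers\<close>

lemma trek_poset_index_finite:
  assumes "finite (pverts G)" "S \<subseteq> {(i, j). i \<in> pverts G \<and> j \<in> pverts G \<and> i \<le> j}"
  shows "finite S"
  by (rule finite_subset[of _ "pverts G \<times> pverts G"]) (use assms in auto)

lemma finite_trek_poset:
  assumes "finite (pverts G)"
  shows "finite (trek_poset G)"
proof -
  let ?X = "{(i, j). i \<in> pverts G \<and> j \<in> pverts G \<and> i \<le> j}"
  have "finite ?X" using assms trek_poset_index_finite by blast
  moreover have "trek_poset G \<subseteq> (\<lambda>S. Inf_fin ((\<lambda>(i, j). trek_vector G i j) ` S)) ` Pow ?X"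
    unfolding trek_poset_def by blast
  ultimately show ?thesis by (meson finite_Pow_iff finite_imageI finite_subset)
qed

text \<open>The meet belongs to the union of the two index sets.\<close>

lemma inf_in_trek_poset:
  assumes "finite (pverts G)" "s \<in> trek_poset G" "t \<in> trek_poset G"
  shows "inf s t \<in> trek_poset G"
proof -
  let ?X = "{(i, j). i \<in> pverts G \<and> j \<in> pverts G \<and> i \<le> j}"
  let ?t = "\<lambda>(i, j). trek_vector G i j"
  obtain S where S: "s = Inf_fin (?t ` S)" "S \<noteq> {}" "S \<subseteq> ?X"
    using assms(2) unfolding trek_poset_def by blast
  obtain T where T: "t = Inf_fin (?t ` T)" "T \<noteq> {}" "T \<subseteq> ?X"
    using assms(3) unfolding trek_poset_def by blast
  have "finite S" "finite T" using S T assms(1) trek_poset_index_finite by blast+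
  then have "inf s t = Inf_fin (?t ` (S \<union> T))"
    using S T by (simp add: image_Un Inf_fin.union)
  then show ?thesis
    using S T unfolding trek_poset_def by (auto intro!: exI[of _ "S \<union> T"])
qed

locale finite_rooted_forest = rooted_forest G depth
  for G :: "nat pair_pre_digraph" and depth +
  assumes finite_verts: "finite (pverts G)"
begin

lemma trek_vector_in_trek_poset:
  assumes "i \<in> pverts G" "j \<in> pverts G"
  shows "trek_vector G i j \<in> trek_poset G"
proof -
  have *: "trek_vector G a b \<in> trek_poset G" if "a \<in> pverts G" "b \<in> pverts G" "a \<le> b" for a b
    using that unfolding trek_poset_def by (intro CollectI exI[of _ "{(a, b)}"]) simp
  show ?thesis
    using *[of i j] *[of j i] assms trek_vector_commute[of i j] by (cases "i \<le> j") auto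
qed

lemma trek_poset_below_trek_vector:
  assumes "s \<in> trek_poset G"
  shows "\<exists>i \<in> pverts G. \<exists>j \<in> pverts G. s \<le> trek_vector G i j"
proof -
  let ?t = "\<lambda>(i, j). trek_vector G i j"
  obtain S where S: "s = Inf_fin (?t ` S)" "S \<noteq> {}"
      "S \<subseteq> {(i, j). i \<in> pverts G \<and> j \<in> pverts G \<and> i \<le> j}"
    using assms unfolding trek_poset_def by blast
  then obtain i j where ij: "(i, j) \<in> S" by auto
  have "finite S" using S(3) finite_verts trek_poset_index_finite by blast
  then have "s \<le> ?t (i, j)"
    unfolding S(1) using ij by (intro Inf_fin.coboundedI) auto
  then show ?thesis using S ij by auto
qed

lemma step2_interval_trek_poset:
  assumes "s \<in> trek_poset G"
  shows "step2_interval s"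
proof -
  let ?t = "\<lambda>(i, j). trek_vector G i j"
  obtain S where S: "s = Inf_fin (?t ` S)" "S \<noteq> {}"
      "S \<subseteq> {(i, j). i \<in> pverts G \<and> j \<in> pverts G \<and> i \<le> j}"
    using assms unfolding trek_poset_def by blast
  have "finite S" using S(3) finite_verts trek_poset_index_finite by blast
  then have "step2_interval (Inf_fin (?t ` S))" using S(2)
  proof (induction S rule: finite_ne_induct)
    case (singleton x)
    then show ?case by (cases x) (simp add: step2_interval_trek_vector)
  next
    case (insert x F)
    have "step2_interval (inf (?t x) (Inf_fin (?t ` F)))"
      by (rule step2_interval_inf[OF _ insert.IH])
        (simp add: case_prod_unfold step2_interval_trek_vector)
    then show ?case using insert.hyps by (simp add: Inf_fin.insert del: inf_apply)
  qed
  then show ?thesis using S by simp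
qed

text \<open>The element \<open>u\<close> has every smaller index of the parity of \<open>d\<close>
  in its support, so it bounds all 0/1 vectors supported on these indices.\<close>

lemma trek_poset_drop_top:
  assumes s: "s \<in> trek_poset G" and d: "s d \<noteq> 0" "2 \<le> d"
  shows "\<exists>u \<in> trek_poset G. u d = 0 \<and> (\<forall>k<d. even k = even d \<longrightarrow> u k = 1)"
proof -
  obtain i j where ij: "i \<in> pverts G" "j \<in> pverts G" "s \<le> trek_vector G i j"
    using trek_poset_below_trek_vector s by blast
  then have "trek_vector G i j d \<noteq> 0" using d by (metis le_fun_def le_zero_eq)
  then have d_le: "d \<le> max_trek_length G" "d \<in> trek_lengths i j"
    by (auto simp: trek_vector_eq split: if_splits)
  then have "d \<le> depth i + depth j" using trek_lengths_le by blast
  \<comment> \<open>Some trek has length \<open>d\<close>, so the deeper of its end points has depth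
    at least \<open>d / 2\<close>, enough for a full progression ending in
    \<open>d - 2\<close>.\<close>
  then have "d - 2 \<le> 2 * depth i \<or> d - 2 \<le> 2 * depth j" by linarith
  then obtain v where "v \<in> pverts G" "d - 2 \<le> 2 * depth v" using ij by blast
  from full_trek_lengths[OF this] obtain x y where xy: "x \<in> pverts G" "y \<in> pverts G"
      "trek_lengths x y = {k. k \<le> d - 2 \<and> even k = even (d - 2)}"
    by blast
  have "k \<in> trek_lengths x y" if "k < d" "even k = even d" for k
  proof -
    have "k \<noteq> d - 1" using that(2) d(2) by auto
    then show ?thesis using that d(2) xy(3) by auto
  qed
  moreover have "d \<notin> trek_lengths x y" using xy(3) d(2) by auto
  ultimately show ?thesis
    using trek_vector_in_trek_poset[OF xy(1,2)] d_le(1)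
    by (intro bexI[of _ "trek_vector G x y"]) (auto simp: trek_vector_eq)
qed

text \<open>The lower covers are split by whether \<open>d\<close> is in their support; each of the
  two classes has at most one member.\<close>

lemma card_lower_cover_trek_poset:
  assumes s: "s \<in> trek_poset G"
  shows "card (lower_cover (trek_poset G) s) \<le> 2"
proof (cases "\<forall>k. s k = 0")
  case True
  have "lower_cover (trek_poset G) s = {}"
  proof (rule equals0I)
    fix w assume "w \<in> lower_cover (trek_poset G) s"
    then have "w < s" by (simp add: lower_cover_def covers_in_def)
    moreover have "s \<le> w" using True by (simp add: le_fun_def)
    ultimately show False by simp
  qed
  then show ?thesis by simp
next
  case False
  define L where "L = lower_cover (trek_poset G) s"
  define d where "d = Max {k. s k \<noteq> 0}"
  obtain i j where ij: "s \<le> trek_vector G i j"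
    using trek_poset_below_trek_vector s by blast
  have "k \<le> max_trek_length G" if "s k \<noteq> 0" for k
    using le_funD[OF ij, of k] that by (auto simp: trek_vector_eq split: if_splits)
  then have "{k. s k \<noteq> 0} \<subseteq> {..max_trek_length G}" by auto
  then have fin: "finite {k. s k \<noteq> 0}" by (rule finite_subset) simp
  have d: "s d \<noteq> 0" using Max_in[OF fin] False unfolding d_def by auto
  have le_d: "k \<le> d" if "s k \<noteq> 0" for k using Max_ge[OF fin] that unfolding d_def by auto
  have s2: "step2_interval s" using step2_interval_trek_poset s .
  have L: "w \<in> trek_poset G" "w < s" if "w \<in> L" for w
    using that unfolding L_def lower_cover_def covers_in_def by auto
  have nz: "s k \<noteq> 0 \<and> k \<le> d \<and> even k = even d" if "w \<in> L" "w k \<noteq> 0" for w k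
  proof -
    have "w k \<le> s k" using L(2)[OF that(1)] by (simp add: less_fun_def le_fun_def)
    then have "s k \<noteq> 0" using that(2) by simp
    then show ?thesis using le_d step2_interval_parity[OF s2 _ d] by blast
  qed
  have L1: "w k \<le> 1" if "w \<in> L" for w k
    using step2_interval_trek_poset[OF L(1)[OF that]] by (rule step2_interval_le_1)
  have finL: "finite L"
    unfolding L_def using finite_lower_cover finite_trek_poset finite_verts by blast
  let ?A = "{w \<in> L. w d = 0}" and ?B = "{w \<in> L. w d \<noteq> 0}"
  have "v = w" if vw: "v \<in> ?A" "w \<in> ?A" for v w
  proof (cases "2 \<le> d")
    case True
    then obtain u where u: "u \<in> trek_poset G" "u d = 0" "\<And>k. k < d \<Longrightarrow> even k = even d \<Longrightarrow> u k = 1"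
      using trek_poset_drop_top s d by blast
    \<comment> \<open>Such a cover lies below \<open>inf s u\<close>, which is strictly below
      \<open>s\<close> because it vanishes at \<open>d\<close>; a cover leaves no room
      between.\<close>
    have "x = inf s u" if x: "x \<in> ?A" for x
    proof -
      have "x k \<le> u k" for k
      proof (cases "x k = 0")
        case False
        moreover from this x have "k \<noteq> d" by (cases "k = d") auto
        ultimately have "u k = 1" using nz[of x k] x u(3)[of k] by auto
        then show ?thesis using L1 x by simp
      qed simp
      then have "x \<le> inf s u" using L(2) x by (auto simp: le_fun_def less_fun_def)
      moreover have "inf s u < s"
        using d u(2) by (metis inf.cobounded1 inf.orderE inf_fun_def inf_nat_def le_zero_eq
            min.cobounded2 order.not_eq_order_implies_strict)
      ultimately show ?thesis
        using lower_cover_eq[of x] x inf_in_trek_poset[OF finite_verts s u(1)]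
        unfolding L_def by blast
    qed
    then show ?thesis using vw by blast
  next
    case False
    \<comment> \<open>For \<open>d < 2\<close> parity leaves \<open>d\<close> as the only possible
      index, so a cover that vanishes there is zero.\<close>
    have "x k = 0" if x: "x \<in> ?A" for x k
    proof (rule ccontr)
      assume *: "x k \<noteq> 0"
      then have "k \<le> d" "even k = even d" using nz x by blast+
      then have "k = d" using False by presburger
      then show False using x * by simp
    qed
    then show ?thesis using vw by (intro ext) metis
  qed
  then have A: "card ?A \<le> Suc 0" using finL by (subst card_le_Suc0_iff_eq) (simp, blast)
  have "v = w" if vw: "v \<in> ?B" "w \<in> ?B" for v w
  proof -
    \<comment> \<open>Two lower covers that are comparable must coincide.\<close>
    have "v \<le> w \<or> w \<le> v"
    proof (rule step2_interval_comparable)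
      show "step2_interval v" "step2_interval w"
        using vw step2_interval_trek_poset L(1) by blast+
      show "v d \<noteq> 0" "w d \<noteq> 0" using vw by auto
      show "v k = 0 \<and> w k = 0" if "d < k" for k
        using vw nz[of v k] nz[of w k] that by auto
    qed
    then show ?thesis
      using vw L lower_cover_eq[of v] lower_cover_eq[of w] unfolding L_def by blast
  qed
  then have B: "card ?B \<le> Suc 0" using finL by (subst card_le_Suc0_iff_eq) (simp, blast)
  have "L = ?A \<union> ?B" by auto
  from arg_cong[OF this, of card] have "card L \<le> card ?A + card ?B"
    using card_Un_le[of ?A ?B] by linarith
  then show ?thesis using A B unfolding L_def by linarith
qed

end

section \<open>Directed trees are finite rooted forests\<close>

text \<open>
  By acyclicity, directed paths from the root to two parents of \<open>v\<close> avoid \<open>v\<close>; joined at the root,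
  they yield an undirected path between the parents that \<open>v\<close> closes to a cycle.
\<close>

lemma directed_tree_parent_unique:
  assumes dt: "directed_tree m G" and r: "\<And>v. v \<in> pverts G \<Longrightarrow> (r, v) \<in> (parcs G)\<^sup>*"
    and uv: "(u, v) \<in> parcs G" "(u', v) \<in> parcs G"
  shows "u = u'"
proof (rule ccontr)
  assume ne: "u \<noteq> u'"
  let ?E = "parcs G" and ?H = "mk_symmetric (with_proj G)"
  interpret pair_wf_digraph G using dt by (simp add: directed_tree_def)
  have H: "parcs ?H = ?E \<union> ?E\<inverse>" by (auto simp: mk_symmetric_def)
  have acyc: "acyclic ?E" using dt by (simp add: directed_tree_def)
  \<comment> \<open>Adjacency in the underlying undirected graph with \<open>v\<close>
    deleted.\<close>
  define T where "T = {(a, b) \<in> parcs ?H. a \<noteq> v \<and> b \<noteq> v}"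
  have "sym T" unfolding T_def H by (auto simp: sym_def)
  \<comment> \<open>Only descendants of \<open>v\<close> can need \<open>v\<close> on their way from
    the root, and no parent of \<open>v\<close> is a descendant of it.\<close>
  have reach: "(v, x) \<notin> ?E\<^sup>* \<longrightarrow> (r, x) \<in> T\<^sup>*" if "(r, x) \<in> ?E\<^sup>*" for x
    using that
  proof (induction rule: rtrancl_induct)
    case (step y z)
    show ?case
    proof
      assume z: "(v, z) \<notin> ?E\<^sup>*"
      then have y: "(v, y) \<notin> ?E\<^sup>*" using step.hyps(2) by (meson rtrancl.rtrancl_into_rtrancl)
      then have "(y, z) \<in> T" using step.hyps(2) z unfolding T_def H by auto
      then show "(r, z) \<in> T\<^sup>*" using step.IH y by (meson rtrancl.rtrancl_into_rtrancl)
    qed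
  qed simp
  have "(v, x) \<notin> ?E\<^sup>*" if "(x, v) \<in> ?E" for x
    using acyc that by (metis acyclic_def rtrancl_into_trancl1)
  then have ru: "(r, u) \<in> T\<^sup>*" "(r, u') \<in> T\<^sup>*"
    using reach r uv in_arcsD1 by blast+
  have uV: "u \<in> pverts G" "v \<in> pverts G" "u \<noteq> v"
    using uv in_arcsD1 in_arcsD2 acyc by (auto simp: acyclic_def)
  have "(u, u') \<in> T\<^sup>*"
    using ru \<open>sym T\<close> by (meson rtrancl_trans sym_rtrancl symD)
  then have "\<exists>p. vwalk p (with_proj ?H) \<and> v \<notin> set p \<and> hd p = u \<and> last p = u'"
  proof (induction rule: rtrancl_induct)
    case base
    then show ?case using uV by (intro exI[of _ "[u]"]) simp
  next
    case (step y z)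
    then obtain p where p: "vwalk p (with_proj ?H)" "v \<notin> set p" "hd p = u" "last p = y" by blast
    have "p \<noteq> []" using p(1) by auto
    moreover have "(y, z) \<in> parcs ?H" "z \<noteq> v" "z \<in> pverts G"
      using step.hyps in_arcsD1 in_arcsD2 unfolding T_def H by auto
    ultimately show ?case using p
      by (intro exI[of _ "p @ [z]"]) (auto simp: vwalk_def vwalk_arcs_append)
  qed
  then obtain p where p: "vwalk p (with_proj ?H)" "v \<notin> set p" "hd p = u" "last p = u'" by blast
  \<comment> \<open>Repeated vertices are cut out, since an undirected cycle is given by a
    path.\<close>
  define q where "q = vwalk_to_vpath p"
  have q: "vpath q (with_proj ?H)" "v \<notin> set q" "hd q = u" "last q = u'"
    using p vwalk_to_vpath_vpath vwalk_to_vpath_subset vwalk_to_vpath_hd vwalk_to_vpath_last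
    unfolding q_def by metis+
  have "q \<noteq> []" using q(1) by auto
  \<comment> \<open>As \<open>u\<close> and \<open>u'\<close> differ, \<open>q\<close> has at least
    two vertices, and \<open>v\<close> is the third that the cycle requires.\<close>
  then have "length q \<noteq> 0" "length q \<noteq> 1" using q(3,4) ne by (auto simp: length_Suc_conv)
  then have len: "length (v # q) \<ge> 3" unfolding length_Cons by linarith
  have "vwalk (v # q) (with_proj ?H)"
    using q uV uv(1) by (intro vwalk_consI) (auto simp: H)
  then have "vpath (v # q) (with_proj ?H)"
    using q(1,2) by (intro vpathI) (simp_all add: vpath_def)
  moreover have "(last (v # q), hd (v # q)) \<in> parcs ?H"
    using \<open>q \<noteq> []\<close> q(4) uv(2) by (simp add: H)
  ultimately show False
    using len dt unfolding directed_tree_def underlying_tree_def by blast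
qed

text \<open>The depth is the number of arcs from the unique source \<open>r\<close>. Climbing from
  any vertex must stop, by well-foundedness, at a source, that is at \<open>r\<close>.\<close>

lemma directed_tree_finite_rooted_forest:
  assumes dt: "directed_tree m G"
  shows "\<exists>depth. finite_rooted_forest G depth"
proof -
  let ?E = "parcs G"
  interpret pair_wf_digraph G using dt by (simp add: directed_tree_def)
  obtain r where r: "\<nexists>u. (u, r) \<in> ?E"
    and r_unique: "\<And>x. x \<in> pverts G \<Longrightarrow> \<nexists>u. (u, x) \<in> ?E \<Longrightarrow> x = r"
    using dt unfolding directed_tree_def by blast
  have fin: "finite (pverts G)" using dt by (simp add: directed_tree_def)
  have sub: "?E \<subseteq> pverts G \<times> pverts G" using in_arcsD1 in_arcsD2 by auto
  then have "finite ?E" using fin by (meson finite_SigmaI finite_subset)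
  then have wf: "wf ?E" using dt finite_acyclic_wf by (auto simp: directed_tree_def)
  have reach: "(r, v) \<in> ?E\<^sup>*" if "v \<in> pverts G" for v
    using wf that
  proof (induction v rule: wf_induct_rule)
    case (less v)
    show ?case
    proof (cases "\<exists>u. (u, v) \<in> ?E")
      case True
      then obtain u where "(u, v) \<in> ?E" by blast
      then show ?thesis using less.IH in_arcsD1 by (meson rtrancl.rtrancl_into_rtrancl)
    next
      case False
      then show ?thesis using r_unique less.prems by auto
    qed
  qed
  have parent: "u = u'" if "(u, v) \<in> ?E" "(u', v) \<in> ?E" for u u' v
    using directed_tree_parent_unique[OF dt reach] that by blast
  \<comment> \<open>Removing the last arc from both paths reaches the same parent; \<open>r\<close>
    has no parent, so both counts reach 0 together.\<close>
  have uniq: "n = n'" if "(r, v) \<in> ?E ^^ n" "(r, v) \<in> ?E ^^ n'" for v n n'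
    using that
  proof (induction n arbitrary: v n')
    case 0
    then show ?case using r by (cases n') auto
  next
    case (Suc n)
    then obtain u where u: "(r, u) \<in> ?E ^^ n" "(u, v) \<in> ?E" by auto
    show ?case
    proof (cases n')
      case 0
      then show ?thesis using Suc.prems u r by auto
    next
      case (Suc k)
      then obtain u' where u': "(r, u') \<in> ?E ^^ k" "(u', v) \<in> ?E" using Suc.prems(2) by auto
      then have "u = u'" using u(2) parent by blast
      then show ?thesis using Suc.IH u(1) u'(1) Suc by blast
    qed
  qed
  define depth where "depth = (\<lambda>v. THE n. (r, v) \<in> ?E ^^ n)"
  have depth_eq: "depth v = n" if "(r, v) \<in> ?E ^^ n" for v n
    unfolding depth_def using that uniq by blast
  have depth: "(r, v) \<in> ?E ^^ depth v" if "v \<in> pverts G" for v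
    using depth_eq reach[OF that] by (metis rtrancl_imp_relpow)
  have "finite_rooted_forest G depth"
  proof unfold_locales
    fix u v assume uv: "(u, v) \<in> ?E"
    then have "(r, v) \<in> ?E ^^ Suc (depth u)" using depth[OF in_arcsD1[OF uv]] by auto
    then show "depth v = Suc (depth u)" by (rule depth_eq)
  next
    fix v assume "v \<in> pverts G" "0 < depth v"
    then show "\<exists>u. (u, v) \<in> ?E" using depth[of v] by (cases "depth v") auto
  qed (use sub parent fin in auto)
  then show ?thesis by blast
qed

theorem lemma4p15:
  fixes m :: nat and G :: "nat pair_pre_digraph" and s s' :: "nat \<Rightarrow> nat"
  assumes "directed_tree m G"
    and "s \<in> trek_poset G" and "s' \<in> trek_poset G" and "s' \<le> s"
  shows "(card (lower_cover (trek_poset G) s) > 1 \<longrightarrow>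
            moebius (trek_poset G) s' s =
              (if covers_in (trek_poset G) s s' then -1
               else if s' = s \<or> s' = Inf_fin (lower_cover (trek_poset G) s) then 1
               else 0)) \<and>
         (card (lower_cover (trek_poset G) s) = 1 \<longrightarrow>
            moebius (trek_poset G) s' s =
              (if covers_in (trek_poset G) s s' then -1
               else if s' = s then 1
               else 0))"
proof -
  let ?P = "trek_poset G"
  from assms(1) obtain depth where "finite_rooted_forest G depth"
    using directed_tree_finite_rooted_forest by blast
  then interpret finite_rooted_forest G depth .
  have fin: "finite ?P" using finite_trek_poset finite_verts by blast
  \<comment> \<open>As there are at most two lower covers, more than one means exactly two, and the
    meet of the whole lower cover is \<open>inf v w\<close>.\<close>
  have "card (lower_cover ?P s) = 2 \<Longrightarrow>
    moebius ?P s' s = (if covers_in ?P s s' then -1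
      else if s' = s \<or> s' = Inf_fin (lower_cover ?P s) then 1 else 0)"
  proof -
    assume "card (lower_cover ?P s) = 2"
    then obtain v w where vw: "lower_cover ?P s = {v, w}" "v \<noteq> w" by (auto simp: card_2_iff)
    then have "v \<in> ?P" "w \<in> ?P" by (auto simp: lower_cover_def covers_in_def)
    then have "inf v w \<in> ?P" using inf_in_trek_poset finite_verts by blast
    then show ?thesis
      using moebius_two_lower_covers[OF fin assms(2-4) vw] vw(1) by simp
  qed
  moreover have "card (lower_cover ?P s) = 1 \<Longrightarrow>
    moebius ?P s' s = (if covers_in ?P s s' then -1 else if s' = s then 1 else 0)"
    using moebius_single_lower_cover[OF fin assms(2-4)] by (auto simp: card_1_singleton_iff)
  ultimately show ?thesis
    using card_lower_cover_trek_poset[OF assms(2)] by (auto simp: le_less_Suc_eq less_Suc_eq_le)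
qed

end
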